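(* Let $A$ be a skew brace and let $I\subset A$ be an ideal of $A$. Let $[I,A]_{\mathsf{Grp}}$ be the subgroup of the additive group $(A,+)$ generated by the set $$\{\, a*b,\quad b*a,\quad c+b*a-c \;\mid\; a\in I,\ b,c\in A \,\}.$$ Then $[I,A]_{\mathsf{Grp}}$ is an ideal of $A$.
   Context: A skew brace is a triple $(A,+,\circ)$ where $(A,+)$ and $(A,\circ)$ are (not necessarily abelian) groups such that $a\circ(b+c)=a\circ b-a+a\circ c$ for all $a,b,c\in A$. (The two groups have the same identity element, denoted $0$.) For $a,b\in A$ put $a*b=-a+a\circ b-b$. An ideal of $A$ is a normal subgroup $I$ of $(A,+)$ such that $a*x\in I$ and $x*a\in I$ for all $a\in A$, $x\in I$. *)

theory Defs
  imports "HOL-Algebra.Generated_Groups" "HOL-Algebra.Ring"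
begin

text \<open>
  A skew brace is carried by the record type of HOL-Algebra rings, used only as a signature with two
  binary operations: \<open>\<oplus>\<close> is the additive operation, and \<open>\<otimes>\<close> is the circle operation
  \<open>\<circ>\<close>. Neither is assumed commutative. Correspondingly \<open>\<ominus>\<close> is the inverse of the
  possibly non-abelian additive group, and \<open>x \<ominus> y\<close> is \<open>x \<oplus> (\<ominus> y)\<close>, in this order.
  That \<open>\<zero> = \<one>\<close> is a consequence of the axioms.
\<close>

locale skew_brace =
  fixes A (structure)
  assumes add_group: "group (add_monoid A)"
    and circ_group: "group A"
    and circ_add_distrib:
      "\<lbrakk> a \<in> carrier A; b \<in> carrier A; c \<in> carrier A \<rbrakk>
        \<Longrightarrow> a \<otimes> (b \<oplus> c) = a \<otimes> b \<ominus> a \<oplus> a \<otimes> c"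

definition star :: "[('a, 'm) ring_scheme, 'a, 'a] \<Rightarrow> 'a" (infixl "\<star>\<index>" 70)
  where "a \<star>\<^bsub>A\<^esub> b = \<ominus>\<^bsub>A\<^esub> a \<oplus>\<^bsub>A\<^esub> a \<otimes>\<^bsub>A\<^esub> b \<ominus>\<^bsub>A\<^esub> b"

definition skew_brace_ideal :: "'a set \<Rightarrow> ('a, 'm) ring_scheme \<Rightarrow> bool"
  where "skew_brace_ideal I A \<longleftrightarrow>
    I \<lhd> add_monoid A \<and>
    (\<forall>a \<in> carrier A. \<forall>x \<in> I. a \<star>\<^bsub>A\<^esub> x \<in> I \<and> x \<star>\<^bsub>A\<^esub> a \<in> I)"

definition grp_commutator :: "('a, 'm) ring_scheme \<Rightarrow> 'a set \<Rightarrow> 'a set"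
  where "grp_commutator A I = generate (add_monoid A)
    ({a \<star>\<^bsub>A\<^esub> b | a b. a \<in> I \<and> b \<in> carrier A} \<union>
     {b \<star>\<^bsub>A\<^esub> a | a b. a \<in> I \<and> b \<in> carrier A} \<union>
     {c \<oplus>\<^bsub>A\<^esub> b \<star>\<^bsub>A\<^esub> a \<ominus>\<^bsub>A\<^esub> c | a b c. a \<in> I \<and> b \<in> carrier A \<and> c \<in> carrier A})"

end

theory Submission
  imports Defs
begin

text \<open>
  The additive conjugates of \<open>a * b\<close> for \<open>a \<in> I\<close> are not among the generators, but they lie in the
  subgroup because \<open>c + a * b - c = -(a * c) + a * (c + b)\<close>; hence the subgroup is normal. It is
  contained in \<open>I\<close>, so its star products with elements of \<open>A\<close> are generators again.
\<close>

text \<open>After rewriting with \<open>m_assoc\<close> all products nest to the right, and an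
  element meets its inverse in exactly these two shapes.\<close>

lemma (in group) inv_mult_cancel:
  assumes "x \<in> carrier G" "y \<in> carrier G"
  shows "inv x \<otimes> (x \<otimes> y) = y" "x \<otimes> (inv x \<otimes> y) = y"
  using assms by (simp_all flip: m_assoc)

text \<open>Conjugation by a fixed \<open>g\<close> respects products and inverses, so it is enough
  to control it on the generators.\<close>

lemma (in group) generate_normalI:
  assumes S: "S \<subseteq> carrier G"
    and conj: "\<And>g s. \<lbrakk> g \<in> carrier G; s \<in> S \<rbrakk> \<Longrightarrow> g \<otimes> s \<otimes> inv g \<in> generate G S"
  shows "generate G S \<lhd> G"
proof (rule normal_invI[OF generate_is_subgroup[OF S]])
  fix g h
  assume g: "g \<in> carrier G" and "h \<in> generate G S"
  from this(2) show "g \<otimes> h \<otimes> inv g \<in> generate G S"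
  proof (induction rule: generate.induct)
    case one
    show ?case using g by (simp add: generate.one)
  next
    case (incl h)
    then show ?case using conj g by blast
  next
    case (inv h)
    then have "h \<in> carrier G" using S by blast
    then have "g \<otimes> inv h \<otimes> inv g = inv (g \<otimes> h \<otimes> inv g)"
      using g by (simp add: inv_mult_group m_assoc)
    then show ?case
      using generate_m_inv_closed[OF S conj[OF g inv]] by simp
  next
    case (eng h1 h2)
    then have "h1 \<in> carrier G" "h2 \<in> carrier G"
      using generate_in_carrier[OF S] by blast+
    then have "g \<otimes> (h1 \<otimes> h2) \<otimes> inv g = (g \<otimes> h1 \<otimes> inv g) \<otimes> (g \<otimes> h2 \<otimes> inv g)"
      using g by (simp add: m_assoc inv_mult_cancel)
    then show ?case
      using generate.eng[OF eng.IH] by simp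
  qed
qed

context skew_brace
begin

text \<open>The rewrites put the facts on the additive group into the ring notation in which
  \<open>star\<close> is defined.\<close>

sublocale add: group "add_monoid A"
  rewrites "carrier (add_monoid A) = carrier A"
    and "monoid.mult (add_monoid A) = (\<oplus>)"
    and "one (add_monoid A) = \<zero>"
    and "m_inv (add_monoid A) = a_inv A"
  using add_group by (simp_all add: a_inv_def)

sublocale circ: group A
  by (rule circ_group)

lemma star_closed:
  "\<lbrakk> a \<in> carrier A; b \<in> carrier A \<rbrakk> \<Longrightarrow> a \<star> b \<in> carrier A"
  by (simp add: star_def a_minus_def)

text \<open>Expanding the left side by the brace axiom gives \<open>\<ominus> a \<oplus> a \<otimes>
  b \<ominus> a \<oplus> a \<otimes> c \<ominus> c \<ominus> b\<close>; inserting
  \<open>\<ominus> b \<oplus> b\<close> after \<open>a \<otimes> b\<close> splits it as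
  claimed.\<close>

lemma star_add_right:
  assumes "a \<in> carrier A" "b \<in> carrier A" "c \<in> carrier A"
  shows "a \<star> (b \<oplus> c) = a \<star> b \<oplus> (b \<oplus> a \<star> c \<ominus> b)"
  using assms
  by (simp add: star_def a_minus_def circ_add_distrib add.m_assoc add.inv_mult_group
      add.inv_mult_cancel)

text \<open>This is \<open>star_add_right\<close> for \<open>c \<oplus> b\<close>, solved for the
  conjugate. The left factor \<open>a\<close> is kept, so for \<open>a \<in> I\<close> both terms on
  the right come from generators.\<close>

lemma conj_star:
  assumes "a \<in> carrier A" "b \<in> carrier A" "c \<in> carrier A"
  shows "c \<oplus> a \<star> b \<ominus> c = \<ominus> (a \<star> c) \<oplus> a \<star> (c \<oplus> b)"
  using assms
  by (simp add: star_add_right star_closed a_minus_def add.inv_solve_left)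

lemma conj_conj:
  assumes "x \<in> carrier A" "c \<in> carrier A" "d \<in> carrier A"
  shows "d \<oplus> (c \<oplus> x \<ominus> c) \<ominus> d = (d \<oplus> c) \<oplus> x \<ominus> (d \<oplus> c)"
  using assms by (simp add: a_minus_def add.m_assoc add.inv_mult_group)

lemma ideal_subset: "skew_brace_ideal I A \<Longrightarrow> I \<subseteq> carrier A"
  using normal_imp_subgroup subgroup.subset unfolding skew_brace_ideal_def by fastforce

lemma grp_commutator_subset:
  assumes "skew_brace_ideal I A"
  shows "grp_commutator A I \<subseteq> I"
proof -
  have N: "I \<lhd> add_monoid A"
    and st: "\<And>a x. \<lbrakk> a \<in> carrier A; x \<in> I \<rbrakk> \<Longrightarrow> a \<star> x \<in> I \<and> x \<star> a \<in> I"
    using assms by (auto simp: skew_brace_ideal_def)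
  \<comment> \<open>Normality of \<open>I\<close> takes care of the third kind of generator.\<close>
  have "c \<oplus> x \<ominus> c \<in> I" if "c \<in> carrier A" "x \<in> I" for c x
    using normal.inv_op_closed2[OF N] that by (simp add: a_minus_def a_inv_def)
  then show ?thesis
    unfolding grp_commutator_def
    by (intro add.generate_subgroup_incl normal_imp_subgroup[OF N]) (use st in auto)
qed

lemma grp_commutator_normal:
  assumes "skew_brace_ideal I A"
  shows "grp_commutator A I \<lhd> add_monoid A"
proof -
  note I = subsetD[OF ideal_subset[OF assms]]
  define S where "S = {a \<star> b | a b. a \<in> I \<and> b \<in> carrier A} \<union>
     {b \<star> a | a b. a \<in> I \<and> b \<in> carrier A} \<union>
     {c \<oplus> b \<star> a \<ominus> c | a b c. a \<in> I \<and> b \<in> carrier A \<and> c \<in> carrier A}"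
  have S: "S \<subseteq> carrier A"
    using I by (auto simp: S_def star_closed a_minus_def)
  have "d \<oplus> s \<ominus> d \<in> generate (add_monoid A) S" if d: "d \<in> carrier A" and s: "s \<in> S" for d s
  proof -
    from s consider
        (left) a b where "a \<in> I" "b \<in> carrier A" "s = a \<star> b"
      | (right) a b where "a \<in> I" "b \<in> carrier A" "s = b \<star> a"
      | (conj) a b c where "a \<in> I" "b \<in> carrier A" "c \<in> carrier A" "s = c \<oplus> b \<star> a \<ominus> c"
      unfolding S_def by blast
    then show ?thesis
    proof cases
      case left
      \<comment> \<open>These are the two star products in \<open>conj_star\<close>, both of the
        first kind since \<open>a \<in> I\<close>.\<close>
      have "a \<star> d \<in> S" "a \<star> (d \<oplus> b) \<in> S"
        using left d unfolding S_def by (blast intro: add.m_closed)+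
      then have "\<ominus> (a \<star> d) \<oplus> a \<star> (d \<oplus> b) \<in> generate (add_monoid A) S"
        using generate.eng[OF generate.inv generate.incl, of _ S _ "add_monoid A"]
        by (simp add: a_inv_def)
      then show ?thesis
        using conj_star left d I by simp
    next
      case right
      \<comment> \<open>A conjugate of a generator of the second kind is one of the third
        kind.\<close>
      then have "d \<oplus> s \<ominus> d \<in> S" using d unfolding S_def by blast
      then show ?thesis by (rule generate.incl)
    next
      case conj
      \<comment> \<open>Two successive conjugations are one conjugation by
        \<open>d \<oplus> c\<close>, so the third kind is stable.\<close>
      then have "d \<oplus> s \<ominus> d = (d \<oplus> c) \<oplus> b \<star> a \<ominus> (d \<oplus> c)"
        using conj_conj star_closed d I by simp
      moreover have "d \<oplus> c \<in> carrier A" using conj d by simp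
      ultimately have "d \<oplus> s \<ominus> d \<in> S" using conj unfolding S_def by blast
      then show ?thesis by (rule generate.incl)
    qed
  qed
  then have "generate (add_monoid A) S \<lhd> add_monoid A"
    by (intro add.generate_normalI S) (simp add: a_minus_def)
  then show ?thesis
    by (simp add: grp_commutator_def S_def)
qed

end

theorem proposition3p3:
  fixes A (structure)
  assumes "skew_brace A"
    and "skew_brace_ideal I A"
  shows "skew_brace_ideal (grp_commutator A I) A"
proof -
  interpret skew_brace A by (rule assms(1))
  have "a \<star> x \<in> grp_commutator A I \<and> x \<star> a \<in> grp_commutator A I"
    if "a \<in> carrier A" "x \<in> grp_commutator A I" for a x
  proof -
    \<comment> \<open>With \<open>x \<in> I\<close>, \<open>x \<star> a\<close> is a generator of
      the first kind and \<open>a \<star> x\<close> one of the second.\<close>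
    have "x \<in> I" using that grp_commutator_subset[OF assms(2)] by blast
    with that(1) show ?thesis
      unfolding grp_commutator_def by (blast intro: generate.incl)
  qed
  then show ?thesis
    using grp_commutator_normal[OF assms(2)] by (simp add: skew_brace_ideal_def)
qed

end
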